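(* Let $\alpha>0$ and let $F$ be a distribution function on $\mathbb{R}$, with tail $\bar F=1-F$ and right endpoint $\omega(F)=\sup\{x\in\mathbb{R}:F(x)<1\}\in(-\infty,\infty]$. The following statements are equivalent: (i) $F$ is in the free max-domain of attraction of the distribution function $G$ given by $G(x)=1-|x|^\alpha$ for $-1\le x\le0$, $G(x)=0$ for $x<-1$, $G(x)=1$ for $x>0$. (ii) $F$ is in the classical max-domain of attraction of the Weibull distribution $\Psi_\alpha$, where $\Psi_\alpha(x)=\exp(-|x|^\alpha)$ for $x\le 0$ and $\Psi_\alpha(x)=1$ for $x>0$. (iii) $\omega(F)<\infty$ and $u\mapsto\bar F(\omega(F)-u)$ is regularly varying of exponent $\alpha$ at $0$, i.e. $\lim_{h\downarrow0}\dfrac{\bar F(\omega(F)-xh)}{\bar F(\omega(F)-h)}=x^\alpha$ for all $x>0$. Moreover, when these hold, the normalization constants can be chosen to be $a_n=\omega(F)-u_n$ and $b_n=\omega(F)$ (for all sufficiently large $n$), where $u_n=\inf\{t\in\mathbb{R}:\bar F(t)<n^{-1}\}$.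
   Context: A distribution function on $\mathbb{R}$ is $F(t)=\mu((-\infty,t])$ for a Borel probability measure $\mu$ on $\mathbb{R}$. Write $u_+=\max(u,0)$. For distribution functions $F,G$ put $F\veebar G=(F+G-1)_+$ (upper extremal free convolution); its $n$-fold iterate is $F^{\veebar n}=(nF-(n-1))_+$, equivalently $1-F^{\veebar n}=\min(n(1-F),1)$. $F$ is in the free max-domain of attraction of a distribution function $G$ if there exist normalization constants $a_n,b_n\in\mathbb{R}$, $a_n>0$, such that $F^{\veebar n}(a_nx+b_n)\to G(x)$ as $n\to\infty$ at every continuity point $x$ of $G$. $F$ is in the classical max-domain of attraction of $G$ if there exist normalization constants $a_n,b_n\in\mathbb{R}$, $a_n>0$, such that $F(a_nx+b_n)^n\to G(x)$ at every continuity point $x$ of $G$. *)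

theory Defs
  imports "HOL-Probability.Probability" "HOL-Real_Asymp.Real_Asymp"
begin

definition distribution_function :: "(real \<Rightarrow> real) \<Rightarrow> bool" where
  "distribution_function F \<longleftrightarrow> (\<exists>M. real_distribution M \<and> F = cdf M)"

definition tail :: "(real \<Rightarrow> real) \<Rightarrow> real \<Rightarrow> real" where
  "tail F t = 1 - F t"

definition right_endpoint :: "(real \<Rightarrow> real) \<Rightarrow> ereal" where
  "right_endpoint F = (SUP x\<in>{x. F x < 1}. ereal x)"

definition free_max :: "(real \<Rightarrow> real) \<Rightarrow> (real \<Rightarrow> real) \<Rightarrow> real \<Rightarrow> real" where
  "free_max F G = (\<lambda>t. max (F t + G t - 1) 0)"

text \<open>The iteration starts from the constant function 1, which is neutral for \<^const>\<open>free_max\<close> on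
  distribution functions; the closed form is established below.\<close>

primrec free_max_power :: "nat \<Rightarrow> (real \<Rightarrow> real) \<Rightarrow> real \<Rightarrow> real" where
  "free_max_power 0 F = (\<lambda>t. 1)"
| "free_max_power (Suc n) F = free_max (free_max_power n F) F"

lemma distribution_function_bounds:
  assumes "distribution_function F"
  shows "0 \<le> F t" "F t \<le> 1"
  using assms real_distribution.cdf_bounded_prob
  by (auto simp: distribution_function_def cdf_def)

lemma free_max_power_eq:
  assumes "distribution_function F"
  shows "free_max_power n F t = max (real n * F t - (real n - 1)) 0"
proof (induction n)
  case (Suc n)
  then show ?case
    using distribution_function_bounds[OF assms, of t]
    by (auto simp: free_max_def max_def algebra_simps)
qed simp

lemma free_max_power_1:
  assumes "distribution_function F"
  shows "free_max_power 1 F = F"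
  using distribution_function_bounds[OF assms] by (simp add: free_max_def fun_eq_iff)

text \<open>\<^const>\<open>weak_conv\<close> is pointwise convergence at all continuity points of the limit function.\<close>

definition free_max_norming ::
    "(real \<Rightarrow> real) \<Rightarrow> (real \<Rightarrow> real) \<Rightarrow> (nat \<Rightarrow> real) \<Rightarrow> (nat \<Rightarrow> real) \<Rightarrow> bool" where
  "free_max_norming F G a b \<longleftrightarrow>
     (\<forall>n. a n > 0) \<and> weak_conv (\<lambda>n x. free_max_power n F (a n * x + b n)) G"

definition classical_max_norming ::
    "(real \<Rightarrow> real) \<Rightarrow> (real \<Rightarrow> real) \<Rightarrow> (nat \<Rightarrow> real) \<Rightarrow> (nat \<Rightarrow> real) \<Rightarrow> bool" where
  "classical_max_norming F G a b \<longleftrightarrow>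
     (\<forall>n. a n > 0) \<and> weak_conv (\<lambda>n x. F (a n * x + b n) ^ n) G"

definition in_free_max_domain :: "(real \<Rightarrow> real) \<Rightarrow> (real \<Rightarrow> real) \<Rightarrow> bool" where
  "in_free_max_domain F G \<longleftrightarrow> (\<exists>a b. free_max_norming F G a b)"

definition in_classical_max_domain :: "(real \<Rightarrow> real) \<Rightarrow> (real \<Rightarrow> real) \<Rightarrow> bool" where
  "in_classical_max_domain F G \<longleftrightarrow> (\<exists>a b. classical_max_norming F G a b)"

definition free_weibull :: "real \<Rightarrow> real \<Rightarrow> real" where
  "free_weibull \<alpha> x = (if x < -1 then 0 else if x \<le> 0 then 1 - \<bar>x\<bar> powr \<alpha> else 1)"

definition weibull :: "real \<Rightarrow> real \<Rightarrow> real" where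
  "weibull \<alpha> x = (if x \<le> 0 then exp (- (\<bar>x\<bar> powr \<alpha>)) else 1)"

lemma distribution_functionI:
  assumes "mono F" "\<And>x. isCont F x" "(F \<longlongrightarrow> 0) at_bot" "(F \<longlongrightarrow> 1) at_top"
  shows "distribution_function F"
proof -
  have c: "continuous (at_right x) F" for x
    using assms(2)[of x] by (rule continuous_at_imp_continuous_at_within)
  have "real_distribution (interval_measure F)" "cdf (interval_measure F) = F"
    using assms c by (auto intro!: real_distribution_interval_measure cdf_interval_measure simp: mono_def)
  then show ?thesis
    unfolding distribution_function_def by metis
qed

lemma distribution_function_free_weibull:
  assumes "\<alpha> > 0"
  shows "distribution_function (free_weibull \<alpha>)"
proof -
  have eq: "free_weibull \<alpha> = (\<lambda>x. 1 - (min 1 (max 0 (- x))) powr \<alpha>)"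
    using assms by (auto simp: free_weibull_def fun_eq_iff min_def max_def)
  show ?thesis
  proof (rule distribution_functionI)
    show "mono (free_weibull \<alpha>)"
      unfolding eq using assms by (intro monoI diff_mono order_refl powr_mono2) auto
    show "isCont (free_weibull \<alpha>) x" for x
    proof -
      have "continuous_on UNIV (free_weibull \<alpha>)"
        unfolding eq using assms by (intro continuous_intros continuous_on_powr') auto
      then show ?thesis
        by (simp add: continuous_on_eq_continuous_at)
    qed
    have "\<forall>\<^sub>F x in at_bot. free_weibull \<alpha> x = 0"
      using eventually_gt_at_bot[of "-1"] by eventually_elim (auto simp: free_weibull_def)
    then show "(free_weibull \<alpha> \<longlongrightarrow> 0) at_bot"
      by (rule tendsto_eventually)
    have "\<forall>\<^sub>F x in at_top. free_weibull \<alpha> x = 1"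
      using eventually_gt_at_top[of 0] by eventually_elim (auto simp: free_weibull_def)
    then show "(free_weibull \<alpha> \<longlongrightarrow> 1) at_top"
      by (rule tendsto_eventually)
  qed
qed

lemma distribution_function_weibull:
  assumes "\<alpha> > 0"
  shows "distribution_function (weibull \<alpha>)"
proof -
  have eq: "weibull \<alpha> = (\<lambda>x. exp (- (max 0 (- x) powr \<alpha>)))"
    using assms by (auto simp: weibull_def fun_eq_iff max_def)
  show ?thesis
  proof (rule distribution_functionI)
    show "mono (weibull \<alpha>)"
      unfolding eq using assms by (auto intro!: monoI powr_mono2)
    show "isCont (weibull \<alpha>) x" for x
    proof -
      have "continuous_on UNIV (weibull \<alpha>)"
        unfolding eq using assms by (intro continuous_intros continuous_on_powr') auto
      then show ?thesis
        by (simp add: continuous_on_eq_continuous_at)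
    qed
    have "((\<lambda>x. exp (- ((- x) powr \<alpha>))) \<longlongrightarrow> 0) at_bot"
      using assms by real_asymp
    moreover have "\<forall>\<^sub>F x in at_bot. exp (- ((- x) powr \<alpha>)) = weibull \<alpha> x"
      using eventually_le_at_bot[of 0] by eventually_elim (simp add: weibull_def)
    ultimately show "(weibull \<alpha> \<longlongrightarrow> 0) at_bot"
      by (rule Lim_transform_eventually)
    have "\<forall>\<^sub>F x in at_top. weibull \<alpha> x = 1"
      using eventually_gt_at_top[of 0] by eventually_elim (auto simp: weibull_def)
    then show "(weibull \<alpha> \<longlongrightarrow> 1) at_top"
      by (rule tendsto_eventually)
  qed
qed

definition regularly_varying_at_0 :: "(real \<Rightarrow> real) \<Rightarrow> real \<Rightarrow> bool" where
  "regularly_varying_at_0 f \<alpha> \<longleftrightarrow>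
     (\<forall>x>0. ((\<lambda>h. f (x * h) / f h) \<longlongrightarrow> x powr \<alpha>) (at_right 0))"

text \<open>Since \<open>F x < 1\<close> for some \<open>x\<close>, the right endpoint of a distribution function is never \<open>-\<infinity>\<close>, so
  the conversion to a real number below is faithful once the endpoint is less than \<open>\<infinity>\<close>.\<close>

definition regularly_varying_tail_at_endpoint :: "(real \<Rightarrow> real) \<Rightarrow> real \<Rightarrow> bool" where
  "regularly_varying_tail_at_endpoint F \<alpha> \<longleftrightarrow>
     right_endpoint F < \<infinity> \<and>
     regularly_varying_at_0 (\<lambda>u. tail F (real_of_ereal (right_endpoint F) - u)) \<alpha>"

text \<open>\<^const>\<open>Inf\<close> on the reals is only meaningful for nonempty sets that are bounded below. For a
  distribution function this is the case here whenever \<open>n \<ge> 2\<close>.\<close>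

definition tail_quantile :: "(real \<Rightarrow> real) \<Rightarrow> nat \<Rightarrow> real" where
  "tail_quantile F n = Inf {t. tail F t < 1 / real n}"

end

theory Submission
  imports Defs
begin

text \<open>Write \<open>T = 1 - F\<close>, \<open>\<omega>\<close> for the right endpoint and \<open>U h = T (\<omega> - h)\<close>. The \<open>n\<close>-fold free maximum
  is \<open>(1 - n T)\<^sub>+\<close> and the classical one is \<open>(1 - T)\<^sup>n \<approx> exp (- n T)\<close>, so both domains of attraction
  are governed by the same condition
  \<open>n T (a\<^sub>n x + b\<^sub>n) \<rightarrow> (max 0 (- x))\<^sup>\<alpha>\<close>.
  Classical norming is equivalent to it (\<open>classical_max_norming_iff\<close>). Free norming follows from
  it, but gives it back only where the limit is positive, that is for \<open>x > -1\<close>, because of the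
  truncation at 0. The equivalence therefore comes down to two facts: regular variation yields
  the condition for every \<open>x\<close>, with the stated constants, and the condition for \<open>-1 < x \<le> 0\<close>
  already yields regular variation.

  For the first (\<open>tails_converge_at_endpoint\<close>), the quantile \<open>u\<^sub>n\<close> satisfies \<open>T u\<^sub>n \<le> 1/n\<close> and
  \<open>T \<ge> 1/n\<close> to its left. With \<open>a\<^sub>n = \<omega> - u\<^sub>n\<close> this brackets \<open>n U (a\<^sub>n)\<close> between
  \<open>U (a\<^sub>n) / U (\<lambda> a\<^sub>n) \<rightarrow> \<lambda>\<^sup>-\<^sup>\<alpha>\<close> and 1 for every \<open>\<lambda> > 1\<close>, so \<open>n U (a\<^sub>n) \<rightarrow> 1\<close>; regular variation then
  gives \<open>n U (y a\<^sub>n) \<rightarrow> y\<^sup>\<alpha>\<close>.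

  For the second (\<open>regularly_varying_if_tails_converge\<close>), monotonicity of \<open>T\<close> and strict
  monotonicity of the limit allow the limit relation to be inverted: the size of \<open>n T (p\<^sub>n)\<close>
  determines the position of \<open>p\<^sub>n\<close> relative to \<open>b\<^sub>n\<close>, in units of \<open>a\<^sub>n\<close>. Comparing the constants for
  \<open>2n\<close> with those for \<open>n\<close> shows that the scale shrinks by the factor \<open>2\<^sup>-\<^sup>1\<^sup>/\<^sup>\<alpha> < 1\<close> while the
  location moves by \<open>o(a\<^sub>n)\<close>. Summing the geometric series, the locations along \<open>2\<^sup>k n\<close> never exceed
  \<open>b\<^sub>n + \<epsilon> a\<^sub>n\<close>, and the tails at these locations tend to 0, so \<open>\<omega> \<le> b\<^sub>n + \<epsilon> a\<^sub>n\<close>. On the other side,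
  \<open>n T (b\<^sub>n - \<epsilon> a\<^sub>n)\<close> has a positive limit, so \<open>\<omega> > b\<^sub>n - \<epsilon> a\<^sub>n\<close>. Hence \<open>\<omega>\<close> is finite and
  \<open>(\<omega> - b\<^sub>n) / a\<^sub>n \<rightarrow> 0\<close>. Finally \<open>n\<close> is tied to a continuous parameter \<open>h \<rightarrow> 0\<close> by \<open>n = \<lfloor>c / U h\<rfloor>\<close>:
  inversion locates \<open>\<omega> - h\<close> on the scale of \<open>a\<^sub>n\<close>, hence also \<open>\<omega> - x h\<close>, and the limit relation at
  these two points gives the limit of \<open>U (x h) / U h\<close>.\<close>

section \<open>Tails of distribution functions\<close>

lemma tail_bounds:
  assumes "distribution_function F"
  shows "0 \<le> tail F t" "tail F t \<le> 1"
  using distribution_function_bounds[OF assms, of t] by (auto simp: tail_def)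

lemma tail_antimono:
  assumes "distribution_function F" "s \<le> t"
  shows "tail F t \<le> tail F s"
proof -
  obtain M where M: "real_distribution M" "F = cdf M"
    using assms by (auto simp: distribution_function_def)
  interpret real_distribution M by fact
  show ?thesis
    using assms(2) by (simp add: tail_def M(2) cdf_nondecreasing)
qed

lemma tail_limits:
  assumes "distribution_function F"
  shows "(tail F \<longlongrightarrow> 1) at_bot" "(tail F \<longlongrightarrow> 0) at_top" "(tail F \<longlongrightarrow> tail F t) (at_right t)"
proof -
  obtain M where M: "real_distribution M" "F = cdf M"
    using assms by (auto simp: distribution_function_def)
  interpret real_distribution M by fact
  have "((\<lambda>x. 1 - cdf M x) \<longlongrightarrow> 1 - 0) at_bot" "((\<lambda>x. 1 - cdf M x) \<longlongrightarrow> 1 - 1) at_top"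
    by (intro tendsto_diff tendsto_const cdf_lim_at_bot cdf_lim_at_top_prob)+
  then show "(tail F \<longlongrightarrow> 1) at_bot" "(tail F \<longlongrightarrow> 0) at_top"
    by (simp_all add: tail_def[abs_def] M(2))
  have "((\<lambda>x. 1 - cdf M x) \<longlongrightarrow> 1 - cdf M t) (at_right t)"
    using cdf_is_right_cont[of t] by (intro tendsto_diff tendsto_const) (simp add: continuous_within)
  then show "(tail F \<longlongrightarrow> tail F t) (at_right t)"
    by (simp add: tail_def[abs_def] M(2))
qed

lemma tail_le_if_le_right:
  assumes "distribution_function F" "\<And>s. s > t \<Longrightarrow> tail F s \<le> c"
  shows "tail F t \<le> c"
  by (rule tendsto_upperbound[OF tail_limits(3)[OF assms(1)]])
     (auto simp: eventually_at_filter assms(2))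

text \<open>Right continuity is what makes the tail vanish at the endpoint itself.\<close>

lemma tail_eq_0_iff:
  assumes "distribution_function F"
  shows "tail F x = 0 \<longleftrightarrow> right_endpoint F \<le> ereal x"
proof
  assume 0: "tail F x = 0"
  have "y \<le> x" if "F y < 1" for y
  proof (rule ccontr)
    assume "\<not> y \<le> x"
    then show False
      using tail_antimono[OF assms, of x y] 0 that by (simp add: tail_def)
  qed
  then show "right_endpoint F \<le> ereal x"
    by (auto simp: right_endpoint_def intro!: SUP_least)
next
  assume le: "right_endpoint F \<le> ereal x"
  have "tail F y \<le> 0" if "y > x" for y
  proof (rule ccontr)
    assume "\<not> tail F y \<le> 0"
    then have "ereal y \<le> right_endpoint F"
      by (auto simp: right_endpoint_def tail_def intro!: SUP_upper)
    then show False
      using le that by (metis ereal_less_eq(3) leD order_trans)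
  qed
  then show "tail F x = 0"
    using tail_le_if_le_right[OF assms, of x 0] tail_bounds(1)[OF assms, of x] by force
qed

lemma finite_right_endpointE:
  assumes F: "distribution_function F" and "right_endpoint F < \<infinity>"
  obtains \<omega> where "right_endpoint F = ereal \<omega>" "\<And>x. tail F x = 0 \<longleftrightarrow> \<omega> \<le> x"
proof -
  have "right_endpoint F \<noteq> -\<infinity>"
  proof
    assume "right_endpoint F = -\<infinity>"
    then have "tail F = (\<lambda>x. 0)"
      using tail_eq_0_iff[OF F] by auto
    then show False
      using tail_limits(1)[OF F] by (simp add: tendsto_const_iff)
  qed
  then obtain \<omega> where "right_endpoint F = ereal \<omega>"
    using assms(2) by (cases "right_endpoint F") auto
  then show ?thesis
    using tail_eq_0_iff[OF F] that by simp
qed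

lemma tail_pos_iff:
  assumes "distribution_function F" "\<And>x. tail F x = 0 \<longleftrightarrow> \<omega> \<le> x"
  shows "0 < tail F x \<longleftrightarrow> x < \<omega>"
  using tail_bounds(1)[OF assms(1), of x] assms(2)[of x] by auto

text \<open>For \<open>n \<ge> 2\<close> the set defining the quantile is bounded below, since the tail exceeds \<open>1/2\<close> far to
  the left. Read contrapositively: the tail is at least \<open>1/n\<close> to the left of the quantile.\<close>

lemma tail_quantile_le:
  assumes F: "distribution_function F" and "n \<ge> 2" "tail F t < 1 / real n"
  shows "tail_quantile F n \<le> t"
proof -
  have "\<forall>\<^sub>F x in at_bot. tail F x > 1 / 2"
    using tail_limits(1)[OF F] by (rule order_tendstoD) simp
  then obtain m where m: "\<And>x. x \<le> m \<Longrightarrow> tail F x > 1 / 2"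
    by (auto simp: eventually_at_bot_linorder)
  have "m \<le> x" if "tail F x < 1 / real n" for x
  proof (rule ccontr)
    assume "\<not> m \<le> x"
    then have "tail F x > 1 / 2" using m by simp
    moreover have "1 / real n \<le> 1 / 2" using \<open>n \<ge> 2\<close> by (simp add: field_simps)
    ultimately show False using that by linarith
  qed
  then show ?thesis
    unfolding tail_quantile_def using assms(3) by (intro cInf_lower bdd_belowI[of _ m]) auto
qed

lemma tail_at_tail_quantile_le:
  assumes F: "distribution_function F" and "n > 0"
  shows "tail F (tail_quantile F n) \<le> 1 / real n"
proof (rule tail_le_if_le_right[OF F])
  fix s assume "tail_quantile F n < s"
  moreover have "\<forall>\<^sub>F x in at_top. tail F x < 1 / real n"
    using tail_limits(2)[OF F] by (rule order_tendstoD) (use \<open>n > 0\<close> in simp)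
  then have "{t. tail F t < 1 / real n} \<noteq> {}"
    by (auto simp: eventually_at_top_linorder)
  ultimately obtain t where "tail F t < 1 / real n" "t < s"
    unfolding tail_quantile_def by (metis cInf_lessD mem_Collect_eq)
  then show "tail F s \<le> 1 / real n"
    using tail_antimono[OF F, of t s] by simp
qed

section \<open>Both kinds of norming as convergence of rescaled tails\<close>

lemma ln_one_minus_bounds:
  fixes t :: real
  assumes "0 \<le> t" "t \<le> 1 / 2"
  shows "t \<le> - ln (1 - t)" "- ln (1 - t) \<le> t * (1 + 2 * t)"
proof -
  show "t \<le> - ln (1 - t)"
    using ln_le_minus_one[of "1 - t"] assms by simp
  show "- ln (1 - t) \<le> t * (1 + 2 * t)"
    using ln_one_minus_pos_lower_bound[OF assms] by (simp add: algebra_simps power2_eq_square)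
qed

lemma tendsto_0_if_scaled_tendsto:
  fixes t :: "nat \<Rightarrow> real"
  assumes "(\<lambda>n. real n * t n) \<longlonglongrightarrow> c"
  shows "t \<longlonglongrightarrow> 0"
proof -
  have "(\<lambda>n. inverse (real n) * (real n * t n)) \<longlonglongrightarrow> 0 * c"
    by (intro tendsto_mult assms lim_inverse_n)
  moreover have "\<forall>\<^sub>F n in sequentially. inverse (real n) * (real n * t n) = t n"
    using eventually_gt_at_top[of 0] by eventually_elim simp
  ultimately show ?thesis
    by (auto elim: Lim_transform_eventually)
qed

text \<open>Both directions compare \<open>n t\<^sub>n\<close> with \<open>- n ln (1 - t\<^sub>n)\<close>: as soon as \<open>t\<^sub>n \<rightarrow> 0\<close>, the two differ by a
  factor between 1 and \<open>1 + 2 t\<^sub>n\<close>. Each hypothesis forces \<open>t\<^sub>n \<rightarrow> 0\<close>.\<close>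

lemma one_minus_power_tendsto_exp_iff:
  fixes t :: "nat \<Rightarrow> real"
  assumes t: "\<And>n. 0 \<le> t n" "\<And>n. t n \<le> 1"
  shows "(\<lambda>n. (1 - t n) ^ n) \<longlonglongrightarrow> exp (- c) \<longleftrightarrow> (\<lambda>n. real n * t n) \<longlonglongrightarrow> c"
proof
  assume lim: "(\<lambda>n. real n * t n) \<longlonglongrightarrow> c"
  note t0 = tendsto_0_if_scaled_tendsto[OF lim]
  have small: "\<forall>\<^sub>F n in sequentially. t n < 1 / 2"
    using t0 by (rule order_tendstoD) simp
  have "(\<lambda>n. real n * (- ln (1 - t n))) \<longlonglongrightarrow> c"
  proof (rule tendsto_sandwich[OF _ _ lim])
    show "\<forall>\<^sub>F n in sequentially. real n * t n \<le> real n * (- ln (1 - t n))"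
      using small by eventually_elim (intro mult_left_mono ln_one_minus_bounds(1) t; simp)
    show "\<forall>\<^sub>F n in sequentially. real n * (- ln (1 - t n)) \<le> real n * t n * (1 + 2 * t n)"
      using small
    proof eventually_elim
      case (elim n)
      then show ?case
        using mult_left_mono[OF ln_one_minus_bounds(2)[OF t(1)[of n]], of "real n"]
        by (simp add: mult.assoc)
    qed
    have "(\<lambda>n. real n * t n * (1 + 2 * t n)) \<longlonglongrightarrow> c * (1 + 2 * 0)"
      by (intro tendsto_intros lim t0)
    then show "(\<lambda>n. real n * t n * (1 + 2 * t n)) \<longlonglongrightarrow> c" by simp
  qed
  then have "(\<lambda>n. exp (- (real n * (- ln (1 - t n))))) \<longlonglongrightarrow> exp (- c)"
    by (intro tendsto_intros)
  moreover have "\<forall>\<^sub>F n in sequentially. exp (- (real n * (- ln (1 - t n)))) = (1 - t n) ^ n"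
    using small by eventually_elim (simp add: exp_of_nat_mult)
  ultimately show "(\<lambda>n. (1 - t n) ^ n) \<longlonglongrightarrow> exp (- c)"
    by (rule Lim_transform_eventually)
next
  assume lim: "(\<lambda>n. (1 - t n) ^ n) \<longlonglongrightarrow> exp (- c)"
  define l where "l n = - ln (1 - t n)" for n
  have "\<forall>\<^sub>F n in sequentially. (1 - t n) ^ n > 0"
    using lim by (rule order_tendstoD) simp
  then have pos: "\<forall>\<^sub>F n in sequentially. t n < 1"
    using eventually_gt_at_top[of 0]
  proof eventually_elim
    case (elim n)
    then show ?case using t(2)[of n] by (cases "t n = 1") (auto simp: zero_power)
  qed
  have "(\<lambda>n. - ln ((1 - t n) ^ n)) \<longlonglongrightarrow> - ln (exp (- c))"
    by (intro tendsto_intros lim) simp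
  moreover have "\<forall>\<^sub>F n in sequentially. - ln ((1 - t n) ^ n) = real n * l n"
    using pos by eventually_elim (simp add: l_def ln_realpow)
  ultimately have nl: "(\<lambda>n. real n * l n) \<longlonglongrightarrow> c"
    by (auto elim: Lim_transform_eventually)
  have "(\<lambda>n. 1 - exp (- l n)) \<longlonglongrightarrow> 1 - exp (- 0)"
    by (intro tendsto_intros tendsto_0_if_scaled_tendsto[OF nl])
  moreover have "\<forall>\<^sub>F n in sequentially. 1 - exp (- l n) = t n"
    using pos by eventually_elim (simp add: l_def)
  ultimately have t0: "t \<longlonglongrightarrow> 0"
    by (auto elim: Lim_transform_eventually)
  have small: "\<forall>\<^sub>F n in sequentially. t n < 1 / 2"
    using t0 by (rule order_tendstoD) simp
  show "(\<lambda>n. real n * t n) \<longlonglongrightarrow> c"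
  proof (rule tendsto_sandwich[OF _ _ _ nl])
    show "\<forall>\<^sub>F n in sequentially. real n * t n \<le> real n * l n"
      unfolding l_def
      using small by eventually_elim (intro mult_left_mono ln_one_minus_bounds(1) t; simp)
    show "\<forall>\<^sub>F n in sequentially. real n * l n / (1 + 2 * t n) \<le> real n * t n"
      using small
    proof eventually_elim
      case (elim n)
      then show ?case
        using mult_left_mono[OF ln_one_minus_bounds(2)[OF t(1)[of n]], of "real n"] t(1)[of n]
        by (subst pos_divide_le_eq) (simp_all add: l_def mult.assoc)
    qed
    have "(\<lambda>n. real n * l n / (1 + 2 * t n)) \<longlonglongrightarrow> c / (1 + 2 * 0)"
      by (intro tendsto_intros nl t0) simp
    then show "(\<lambda>n. real n * l n / (1 + 2 * t n)) \<longlonglongrightarrow> c" by simp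
  qed
qed

lemma isCont_free_weibull:
  assumes "\<alpha> > 0"
  shows "isCont (free_weibull \<alpha>) x"
proof -
  have eq: "free_weibull \<alpha> = (\<lambda>x. 1 - (min 1 (max 0 (- x))) powr \<alpha>)"
    using assms by (auto simp: free_weibull_def fun_eq_iff min_def max_def)
  have "continuous_on UNIV (free_weibull \<alpha>)"
    unfolding eq using assms by (intro continuous_intros continuous_on_powr') auto
  then show ?thesis
    by (simp add: continuous_on_eq_continuous_at)
qed

lemma isCont_weibull:
  assumes "\<alpha> > 0"
  shows "isCont (weibull \<alpha>) x"
proof -
  have eq: "weibull \<alpha> = (\<lambda>x. exp (- (max 0 (- x) powr \<alpha>)))"
    using assms by (auto simp: weibull_def fun_eq_iff max_def)
  have "continuous_on UNIV (weibull \<alpha>)"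
    unfolding eq using assms by (intro continuous_intros continuous_on_powr') auto
  then show ?thesis
    by (simp add: continuous_on_eq_continuous_at)
qed

text \<open>The limit is minus the logarithm of the Weibull distribution function. The set \<open>X\<close> of
  evaluation points is a parameter because free norming determines the limit only on
  \<open>{-1<..}\<close>, where \<^const>\<open>free_weibull\<close> is positive.\<close>

definition tails_converge_on ::
    "real set \<Rightarrow> (real \<Rightarrow> real) \<Rightarrow> real \<Rightarrow> (nat \<Rightarrow> real) \<Rightarrow> (nat \<Rightarrow> real) \<Rightarrow> bool" where
  "tails_converge_on X F \<alpha> a b \<longleftrightarrow>
     (\<forall>n. a n > 0) \<and>
     (\<forall>x\<in>X. (\<lambda>n. real n * tail F (a n * x + b n)) \<longlonglongrightarrow> max 0 (- x) powr \<alpha>)"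

lemma classical_max_norming_iff:
  assumes "\<alpha> > 0" and F: "distribution_function F"
  shows "classical_max_norming F (weibull \<alpha>) a b \<longleftrightarrow> tails_converge_on UNIV F \<alpha> a b"
proof -
  have "(\<lambda>n. F (a n * x + b n) ^ n) \<longlonglongrightarrow> weibull \<alpha> x \<longleftrightarrow>
        (\<lambda>n. real n * tail F (a n * x + b n)) \<longlonglongrightarrow> max 0 (- x) powr \<alpha>" for x
  proof -
    have "weibull \<alpha> x = exp (- (max 0 (- x) powr \<alpha>))"
      using assms(1) by (auto simp: weibull_def max_def)
    moreover have "F t = 1 - tail F t" for t
      by (simp add: tail_def)
    ultimately show ?thesis
      using one_minus_power_tendsto_exp_iff[of "\<lambda>n. tail F (a n * x + b n)"
          "max 0 (- x) powr \<alpha>"] tail_bounds[OF F]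
      by simp
  qed
  then show ?thesis
    using isCont_weibull[OF assms(1)]
    by (simp add: classical_max_norming_def tails_converge_on_def weak_conv_def)
qed

lemma free_max_power_tail:
  assumes "distribution_function F"
  shows "free_max_power n F t = max (1 - real n * tail F t) 0"
  by (simp add: free_max_power_eq[OF assms] tail_def algebra_simps)

text \<open>For \<open>-1 < x \<le> 0\<close> the limit \<open>1 - \<bar>x\<bar>\<^sup>\<alpha>\<close> is positive, so the truncation at 0 is eventually inactive
  and the free maximum equals \<open>1 - n T\<close>.\<close>

lemma tails_converge_if_free_max_norming:
  assumes "\<alpha> > 0" and F: "distribution_function F"
    and norming: "free_max_norming F (free_weibull \<alpha>) a b"
  shows "tails_converge_on {-1<..0} F \<alpha> a b"
  unfolding tails_converge_on_def
proof (intro conjI ballI)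
  show "\<forall>n. a n > 0"
    using norming by (simp add: free_max_norming_def)
  fix x :: real assume x: "x \<in> {-1<..0}"
  let ?p = "\<lambda>n. free_max_power n F (a n * x + b n)"
  have "?p \<longlonglongrightarrow> free_weibull \<alpha> x"
    using norming isCont_free_weibull[OF assms(1)]
    by (simp add: free_max_norming_def weak_conv_def)
  then have lim: "?p \<longlonglongrightarrow> 1 - (- x) powr \<alpha>"
    using x by (simp add: free_weibull_def)
  have "(- x) powr \<alpha> < 1"
    using x assms(1) powr_less_mono2[of \<alpha> "- x" 1] by simp
  then have "\<forall>\<^sub>F n in sequentially. ?p n > 0"
    by (intro order_tendstoD(1)[OF lim]) simp
  then have "\<forall>\<^sub>F n in sequentially. 1 - ?p n = real n * tail F (a n * x + b n)"
    by eventually_elim (auto simp: free_max_power_tail[OF F] max_def split: if_splits)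
  moreover have "(\<lambda>n. 1 - ?p n) \<longlonglongrightarrow> 1 - (1 - (- x) powr \<alpha>)"
    by (intro tendsto_intros lim)
  ultimately have "(\<lambda>n. real n * tail F (a n * x + b n)) \<longlonglongrightarrow> (- x) powr \<alpha>"
    by (auto elim: Lim_transform_eventually)
  then show "(\<lambda>n. real n * tail F (a n * x + b n)) \<longlonglongrightarrow> max 0 (- x) powr \<alpha>"
    using x by (simp add: max_def)
qed

lemma free_max_norming_if_tails_converge:
  assumes "\<alpha> > 0" and F: "distribution_function F"
    and conv: "tails_converge_on UNIV F \<alpha> a b"
  shows "free_max_norming F (free_weibull \<alpha>) a b"
  unfolding free_max_norming_def weak_conv_def
proof (intro conjI allI impI)
  show "a n > 0" for n
    using conv by (simp add: tails_converge_on_def)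
  fix x
  have "(\<lambda>n. max (1 - real n * tail F (a n * x + b n)) 0) \<longlonglongrightarrow> max (1 - max 0 (- x) powr \<alpha>) 0"
    using conv by (intro tendsto_intros) (simp add: tails_converge_on_def)
  moreover have "free_weibull \<alpha> x = max (1 - max 0 (- x) powr \<alpha>) 0"
  proof -
    have "(- x) powr \<alpha> \<ge> 1" if "x < -1"
      using that assms(1) ge_one_powr_ge_zero[of "- x" \<alpha>] by simp
    moreover have "(- x) powr \<alpha> \<le> 1" if "-1 \<le> x" "x \<le> 0"
      using that assms(1) powr_le1[of \<alpha> "- x"] by simp
    ultimately show ?thesis
      by (auto simp: free_weibull_def max_def)
  qed
  ultimately show "(\<lambda>n. free_max_power n F (a n * x + b n)) \<longlonglongrightarrow> free_weibull \<alpha> x"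
    by (simp add: free_max_power_tail[OF F])
qed

section \<open>Regular variation at the endpoint gives the norming constants\<close>

lemma endpoint_tail_mono:
  assumes "distribution_function F" "h \<le> k"
  shows "tail F (\<omega> - h) \<le> tail F (\<omega> - k)"
  using assms by (intro tail_antimono) auto

text \<open>Regular variation with \<open>\<alpha> > 0\<close> excludes an atom at the endpoint: halving \<open>h\<close> eventually
  multiplies the tail by a factor at most \<open>r < 1\<close>, so it decays geometrically along \<open>d / 2\<^sup>k\<close>.\<close>

lemma tail_tendsto_0_at_endpoint:
  assumes "\<alpha> > 0" and F: "distribution_function F"
    and end_iff: "\<And>x. tail F x = 0 \<longleftrightarrow> \<omega> \<le> x"
    and rv: "regularly_varying_at_0 (\<lambda>u. tail F (\<omega> - u)) \<alpha>"
  shows "((\<lambda>h. tail F (\<omega> - h)) \<longlongrightarrow> 0) (at_right 0)"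
proof -
  define U where "U h = tail F (\<omega> - h)" for h
  have U_pos: "U h > 0" if "h > 0" for h
    using tail_pos_iff[OF F end_iff] that by (simp add: U_def)
  have U_mono: "U h \<le> U k" if "h \<le> k" for h k
    unfolding U_def by (rule endpoint_tail_mono[OF F that])
  define r where "r = ((1 / 2) powr \<alpha> + 1) / 2"
  have "(1 / 2) powr \<alpha> < (1::real)"
    using assms(1) powr_less_mono2[of \<alpha> "1 / 2" 1] by simp
  then have r: "(1 / 2) powr \<alpha> < r" "0 \<le> r" "r < 1"
    by (simp_all add: r_def)
  have "((\<lambda>h. U (1 / 2 * h) / U h) \<longlongrightarrow> (1 / 2) powr \<alpha>) (at_right 0)"
    using rv unfolding regularly_varying_at_0_def U_def by (metis half_gt_zero zero_less_one)
  then have "\<forall>\<^sub>F h in at_right 0. U (1 / 2 * h) / U h < r"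
    using r(1) by (rule order_tendstoD)
  then obtain d where d: "d > 0" "\<And>h. 0 < h \<Longrightarrow> h < d \<Longrightarrow> U (1 / 2 * h) / U h < r"
    by (auto simp: eventually_at_right_field)
  have half: "U (h / 2) \<le> r * U h" if "0 < h" "h < d" for h
    using d(2)[OF that] U_pos[of h] that by (simp add: divide_less_eq)
  have geom: "U (d / 2 ^ Suc k) \<le> r ^ k" for k
  proof (induction k)
    case 0
    then show ?case using tail_bounds(2)[OF F] by (simp add: U_def)
  next
    case (Suc k)
    have "d / 2 ^ Suc k < d / 1"
      using d(1) by (intro divide_strict_left_mono) (auto intro: power_gt1 simp del: power_Suc)
    then have "U (d / 2 ^ Suc k / 2) \<le> r * U (d / 2 ^ Suc k)"
      using d(1) by (intro half) auto
    also have "\<dots> \<le> r * r ^ k"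
      using Suc r by (intro mult_left_mono)
    finally show ?case by (simp add: mult.commute)
  qed
  have "(U \<longlongrightarrow> 0) (at_right 0)"
  proof (rule order_tendstoI)
    fix e :: real assume "e < 0"
    then show "\<forall>\<^sub>F h in at_right 0. e < U h"
      using tail_bounds(1)[OF F] by (intro always_eventually) (auto simp: U_def intro: less_le_trans)
  next
    fix e :: real assume "0 < e"
    then obtain k where k: "r ^ k < e"
      using real_arch_pow_inv[of e r] r by auto
    have "\<forall>\<^sub>F h in at_right 0. h < d / 2 ^ Suc k"
      using d(1) eventually_at_right_less by (intro order_tendstoD(2)[OF tendsto_ident_at]) auto
    then show "\<forall>\<^sub>F h in at_right 0. U h < e"
    proof eventually_elim
      case (elim h)
      then show ?case
        using U_mono[of h "d / 2 ^ Suc k"] geom[of k] k by linarith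
    qed
  qed
  then show ?thesis by (simp add: U_def[abs_def])
qed

lemma tail_quantile_less_endpoint:
  assumes F: "distribution_function F"
    and lim: "((\<lambda>h. tail F (\<omega> - h)) \<longlongrightarrow> 0) (at_right 0)" and "n \<ge> 2"
  shows "tail_quantile F n < \<omega>"
proof -
  have "\<forall>\<^sub>F h in at_right 0. tail F (\<omega> - h) < 1 / real n"
    using lim by (rule order_tendstoD) (use \<open>n \<ge> 2\<close> in simp)
  then have "\<forall>\<^sub>F h in at_right 0. h > 0 \<and> tail F (\<omega> - h) < 1 / real n"
    using eventually_at_right_less by eventually_elim simp
  then obtain h where "h > 0" "tail F (\<omega> - h) < 1 / real n"
    using eventually_happens'[OF trivial_limit_at_right_real] by blast
  then show ?thesis
    using tail_quantile_le[OF F \<open>n \<ge> 2\<close>, of "\<omega> - h"] by simp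
qed

text \<open>Regular variation at the rescaled points reduces everything to \<open>n U (a\<^sub>n) \<rightarrow> 1\<close>. The tail may jump
  at the quantile, so only \<open>n U (a\<^sub>n) \<le> 1 \<le> n U (\<lambda> a\<^sub>n)\<close> for \<open>\<lambda> > 1\<close> is available; regular
  variation makes \<open>U (a\<^sub>n) / U (\<lambda> a\<^sub>n)\<close> converge to \<open>\<lambda>\<^sup>-\<^sup>\<alpha>\<close>, which is close to 1 for \<open>\<lambda>\<close> close to 1.\<close>

lemma tails_converge_at_endpoint:
  assumes "\<alpha> > 0" and F: "distribution_function F"
    and end_iff: "\<And>x. tail F x = 0 \<longleftrightarrow> \<omega> \<le> x"
    and rv: "regularly_varying_at_0 (\<lambda>u. tail F (\<omega> - u)) \<alpha>"
    and a_pos: "\<And>n. a n > 0"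
    and a: "\<forall>\<^sub>F n in sequentially. a n = \<omega> - tail_quantile F n"
  shows "tails_converge_on UNIV F \<alpha> a (\<lambda>n. \<omega>)"
proof -
  define U where "U h = tail F (\<omega> - h)" for h
  have U_pos: "U h > 0" if "h > 0" for h
    using tail_pos_iff[OF F end_iff] that by (simp add: U_def)
  have U_upper: "\<forall>\<^sub>F n in sequentially. U (a n) \<le> 1 / real n"
    using a eventually_gt_at_top[of 0]
    by eventually_elim (simp add: U_def tail_at_tail_quantile_le[OF F])
  have U_lower: "\<forall>\<^sub>F n in sequentially. 1 / real n \<le> U (l * a n)" if "l > 1" for l
    using a eventually_ge_at_top[of 2]
  proof eventually_elim
    case (elim n)
    have "\<omega> - l * a n < tail_quantile F n"
      using mult_strict_right_mono[OF that a_pos[of n]] elim by simp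
    then show ?case
      using tail_quantile_le[OF F elim(2), of "\<omega> - l * a n"] by (force simp: U_def)
  qed
  have "a \<longlonglongrightarrow> 0"
  proof (rule order_tendstoI)
    fix e :: real assume "e < 0"
    then show "\<forall>\<^sub>F n in sequentially. e < a n"
      using a_pos by (intro always_eventually) (auto intro: less_trans)
  next
    fix e :: real assume "0 < e"
    have "\<forall>\<^sub>F n in sequentially. 1 / real n < U e"
      by (rule order_tendstoD(2)[OF lim_1_over_n U_pos[OF \<open>0 < e\<close>]])
    then show "\<forall>\<^sub>F n in sequentially. a n < e"
      using U_upper
    proof eventually_elim
      case (elim n)
      then have "U (a n) < U e" by simp
      then show ?case
        unfolding U_def using endpoint_tail_mono[OF F, of e "a n" \<omega>] by (meson leD leI)
    qed
  qed
  then have a_0: "filterlim a (at_right 0) sequentially"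
    using a_pos by (intro tendsto_imp_filterlim_at_right always_eventually) auto
  have ratio: "(\<lambda>n. U (x * a n) / U (a n)) \<longlonglongrightarrow> x powr \<alpha>" if "x > 0" for x
    using filterlim_compose[OF rv[unfolded regularly_varying_at_0_def, rule_format, OF that] a_0]
    by (simp add: U_def)
  have one: "(\<lambda>n. real n * U (a n)) \<longlonglongrightarrow> 1"
  proof (rule order_tendstoI)
    fix e :: real assume "e < 1"
    define s where "s = (1 + max e 0) / 2"
    have s: "0 < s" "s < 1" "e < s"
      using \<open>e < 1\<close> by (auto simp: s_def max_def)
    \<comment> \<open>The dilation for which the lower bound \<open>l powr (- \<alpha>)\<close> is exactly \<open>s\<close>.\<close>
    define l where "l = s powr (- 1 / \<alpha>)"
    have "l > 1"
      using powr_less_mono2_neg[of "- 1 / \<alpha>" s 1] s assms(1) by (simp add: l_def)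
    have "l powr \<alpha> = s powr (- 1)"
      using assms(1) by (simp add: l_def powr_powr)
    then have l_powr: "l powr \<alpha> = 1 / s"
      using s by (simp add: powr_minus divide_inverse)
    have "(\<lambda>n. inverse (U (l * a n) / U (a n))) \<longlonglongrightarrow> inverse (1 / s)"
      using ratio[of l] \<open>l > 1\<close> s by (intro tendsto_inverse) (auto simp: l_powr)
    then have "\<forall>\<^sub>F n in sequentially. e < inverse (U (l * a n) / U (a n))"
      by (rule order_tendstoD) (use s in simp)
    then show "\<forall>\<^sub>F n in sequentially. e < real n * U (a n)"
      using U_lower[OF \<open>l > 1\<close>] eventually_gt_at_top[of 0]
    proof eventually_elim
      case (elim n)
      have "U (a n) / U (l * a n) \<le> U (a n) / (1 / real n)"
        using elim U_pos[OF a_pos[of n]] U_pos[of "l * a n"] a_pos[of n] \<open>l > 1\<close>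
        by (intro divide_left_mono) auto
      then show ?case
        using elim by (simp add: mult.commute)
    qed
  next
    fix e :: real assume "1 < e"
    show "\<forall>\<^sub>F n in sequentially. real n * U (a n) < e"
      using U_upper eventually_gt_at_top[of 0]
    proof eventually_elim
      case (elim n)
      then have "real n * U (a n) \<le> 1" by (simp add: field_simps)
      then show ?case using \<open>1 < e\<close> by simp
    qed
  qed
  have "(\<lambda>n. real n * tail F (a n * x + \<omega>)) \<longlonglongrightarrow> max 0 (- x) powr \<alpha>" for x
  proof (cases "x < 0")
    case True
    have "(\<lambda>n. real n * U (a n) * (U (- x * a n) / U (a n))) \<longlonglongrightarrow> 1 * (- x) powr \<alpha>"
      using True by (intro tendsto_mult one ratio) simp
    moreover have "real n * U (a n) * (U (- x * a n) / U (a n)) =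
        real n * tail F (a n * x + \<omega>)" for n
      using U_pos[OF a_pos[of n]] by (simp add: U_def algebra_simps)
    ultimately show ?thesis
      using True by (simp add: max_def)
  next
    case False
    then have "tail F (a n * x + \<omega>) = 0" for n
      using end_iff[of "a n * x + \<omega>"] a_pos[of n] by simp
    then show ?thesis using False by (simp add: max_def)
  qed
  then show ?thesis
    using a_pos by (simp add: tails_converge_on_def)
qed

section \<open>Convergence of rescaled tails forces regular variation\<close>

lemma tail_less_imp_greater:
  assumes "distribution_function F" "(c::real) \<ge> 0" "c * tail F s < c * tail F t"
  shows "t < s"
proof (rule ccontr)
  assume "\<not> t < s"
  then have "c * tail F t \<le> c * tail F s"
    using assms by (intro mult_left_mono tail_antimono) auto
  then show False using assms(3) by simp
qed

text \<open>Inverting the limit relation: if \<open>p\<close> were asymptotically left of \<open>a y + b\<close> with \<open>y < z\<close>, its scaled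
  tail would be at least \<open>(- y)\<^sup>\<alpha> > (- z)\<^sup>\<alpha>\<close> in the limit, and symmetrically on the right. The
  filter is arbitrary so that the sample size may depend on a continuous parameter.\<close>

lemma rescaled_location_tendsto:
  fixes p :: "'i \<Rightarrow> real"
  assumes "\<alpha> > 0" and F: "distribution_function F"
    and conv: "\<And>x. -1 < x \<Longrightarrow> x < 0 \<Longrightarrow> ((\<lambda>i. c i * tail F (a i * x + b i)) \<longlongrightarrow> (- x) powr \<alpha>) \<F>"
    and a: "\<And>i. a i > 0" and c: "\<And>i. c i \<ge> 0"
    and z: "-1 < z" "z < 0"
    and p: "((\<lambda>i. c i * tail F (p i)) \<longlongrightarrow> (- z) powr \<alpha>) \<F>"
  shows "((\<lambda>i. (p i - b i) / a i) \<longlongrightarrow> z) \<F>"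
proof (rule order_tendstoI)
  fix e assume "e < z"
  define y where "y = max e ((z - 1) / 2)"
  have y: "-1 < y" "y < z" "e \<le> y"
    using z \<open>e < z\<close> by (auto simp: y_def max_def)
  have "(- y) powr \<alpha> - (- z) powr \<alpha> > 0"
    using y z assms(1) powr_less_mono2[of \<alpha> "- z" "- y"] by simp
  then have "\<forall>\<^sub>F i in \<F>. c i * tail F (a i * y + b i) - c i * tail F (p i) > 0"
    using y z by (intro order_tendstoD(1)[OF tendsto_diff[OF conv p]]) auto
  then show "\<forall>\<^sub>F i in \<F>. e < (p i - b i) / a i"
  proof eventually_elim
    case (elim i)
    then have "c i * tail F (p i) < c i * tail F (a i * y + b i)"
      by simp
    then have "a i * y + b i < p i"
      by (rule tail_less_imp_greater[OF F c])
    then have "y < (p i - b i) / a i"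
      using a[of i] by (simp add: less_divide_eq mult.commute)
    then show ?case using y by simp
  qed
next
  fix e assume "z < e"
  define y where "y = min e (z / 2)"
  have y: "z < y" "y < 0" "y \<le> e"
    using z \<open>z < e\<close> by (auto simp: y_def min_def)
  have "(- z) powr \<alpha> - (- y) powr \<alpha> > 0"
    using y z assms(1) powr_less_mono2[of \<alpha> "- y" "- z"] by simp
  then have "\<forall>\<^sub>F i in \<F>. c i * tail F (p i) - c i * tail F (a i * y + b i) > 0"
    using y z by (intro order_tendstoD(1)[OF tendsto_diff[OF p conv]]) auto
  then show "\<forall>\<^sub>F i in \<F>. (p i - b i) / a i < e"
  proof eventually_elim
    case (elim i)
    then have "c i * tail F (a i * y + b i) < c i * tail F (p i)"
      by simp
    then have "p i < a i * y + b i"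
      by (rule tail_less_imp_greater[OF F c])
    then have "(p i - b i) / a i < y"
      using a[of i] by (simp add: divide_less_eq mult.commute)
    then show ?case using y by simp
  qed
qed

text \<open>The converse: pointwise limits of monotone functions to a continuous limit persist when the
  evaluation point varies. Here \<open>p\<close> is squeezed between \<open>a y + b\<close> for fixed \<open>y\<close> on either side of
  \<open>z\<close>.\<close>

lemma scaled_tail_tendsto:
  fixes p :: "'i \<Rightarrow> real"
  assumes F: "distribution_function F"
    and conv: "\<And>x. -1 < x \<Longrightarrow> x < 0 \<Longrightarrow> ((\<lambda>i. c i * tail F (a i * x + b i)) \<longlongrightarrow> (- x) powr \<alpha>) \<F>"
    and a: "\<And>i. a i > 0" and c: "\<And>i. c i \<ge> 0"
    and z: "-1 < z" "z < 0"
    and p: "((\<lambda>i. (p i - b i) / a i) \<longlongrightarrow> z) \<F>"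
  shows "((\<lambda>i. c i * tail F (p i)) \<longlongrightarrow> (- z) powr \<alpha>) \<F>"
proof -
  have cont: "((\<lambda>y. (- y) powr \<alpha>) \<longlongrightarrow> (- z) powr \<alpha>) (at z within S)" for S
    using z by (intro tendsto_intros) auto
  show ?thesis
  proof (rule order_tendstoI)
    fix e assume "e < (- z) powr \<alpha>"
    then have "\<forall>\<^sub>F y in at_right z. e < (- y) powr \<alpha>"
      by (rule order_tendstoD(1)[OF cont])
    moreover have "\<forall>\<^sub>F y in at_right z. y < 0"
      using z by (intro order_tendstoD(2)[OF tendsto_ident_at])
    ultimately have "\<forall>\<^sub>F y in at_right z. e < (- y) powr \<alpha> \<and> y < 0 \<and> z < y"
      using eventually_at_right_less by eventually_elim simp
    then obtain y where y: "e < (- y) powr \<alpha>" "y < 0" "z < y"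
      using eventually_happens'[OF trivial_limit_at_right_real] by blast
    have "\<forall>\<^sub>F i in \<F>. e < c i * tail F (a i * y + b i)"
      using y z by (intro order_tendstoD(1)[OF conv]) auto
    moreover have "\<forall>\<^sub>F i in \<F>. (p i - b i) / a i < y"
      using p y(3) by (rule order_tendstoD)
    ultimately show "\<forall>\<^sub>F i in \<F>. e < c i * tail F (p i)"
    proof eventually_elim
      case (elim i)
      then have "p i \<le> a i * y + b i"
        using a[of i] by (simp add: divide_less_eq mult.commute)
      then show ?case
        using elim mult_left_mono[OF tail_antimono[OF F] c[of i]] by (meson less_le_trans)
    qed
  next
    fix e assume "(- z) powr \<alpha> < e"
    then have "\<forall>\<^sub>F y in at_left z. (- y) powr \<alpha> < e"
      by (rule order_tendstoD(2)[OF cont])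
    moreover have "\<forall>\<^sub>F y in at_left z. -1 < y"
      using z by (intro order_tendstoD(1)[OF tendsto_ident_at])
    moreover have "\<forall>\<^sub>F y in at_left z. y < z"
      by (simp add: eventually_at_filter)
    ultimately have "\<forall>\<^sub>F y in at_left z. (- y) powr \<alpha> < e \<and> -1 < y \<and> y < z"
      by eventually_elim simp
    then obtain y where y: "(- y) powr \<alpha> < e" "-1 < y" "y < z"
      using eventually_happens'[OF trivial_limit_at_left_real] by blast
    have "\<forall>\<^sub>F i in \<F>. c i * tail F (a i * y + b i) < e"
      using y z by (intro order_tendstoD(2)[OF conv]) auto
    moreover have "\<forall>\<^sub>F i in \<F>. y < (p i - b i) / a i"
      using p y(3) by (rule order_tendstoD)
    ultimately show "\<forall>\<^sub>F i in \<F>. c i * tail F (p i) < e"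
    proof eventually_elim
      case (elim i)
      then have "a i * y + b i \<le> p i"
        using a[of i] by (simp add: less_divide_eq mult.commute)
      then show ?case
        using elim mult_left_mono[OF tail_antimono[OF F] c[of i]] by (meson le_less_trans)
    qed
  qed
qed

lemma tails_converge_onD:
  assumes "tails_converge_on {-1<..0} F \<alpha> a b"
  shows "a n > 0"
    and "-1 < x \<Longrightarrow> x < 0 \<Longrightarrow> (\<lambda>n. real n * tail F (a n * x + b n)) \<longlonglongrightarrow> (- x) powr \<alpha>"
    and "(\<lambda>n. real n * tail F (b n)) \<longlonglongrightarrow> 0"
proof -
  have *: "(\<lambda>n. real n * tail F (a n * x + b n)) \<longlonglongrightarrow> max 0 (- x) powr \<alpha>" if "-1 < x" "x \<le> 0" for x
    using assms that by (simp add: tails_converge_on_def)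
  show "a n > 0"
    using assms by (simp add: tails_converge_on_def)
  show "(\<lambda>n. real n * tail F (a n * x + b n)) \<longlonglongrightarrow> (- x) powr \<alpha>" if "-1 < x" "x < 0"
    using *[of x] that by (simp add: max_def)
  show "(\<lambda>n. real n * tail F (b n)) \<longlonglongrightarrow> 0"
    using *[of 0] by simp
qed

text \<open>Since \<open>n T (a\<^sub>2\<^sub>n x + b\<^sub>2\<^sub>n) \<rightarrow> (- x)\<^sup>\<alpha> / 2 = (- \<rho> x)\<^sup>\<alpha>\<close> with \<open>\<rho> = 2\<^sup>-\<^sup>1\<^sup>/\<^sup>\<alpha>\<close>, inversion gives
  \<open>(a\<^sub>2\<^sub>n x + b\<^sub>2\<^sub>n - b\<^sub>n) / a\<^sub>n \<rightarrow> \<rho> x\<close>. This expression is affine in \<open>x\<close>, so two values of \<open>x\<close> determine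
  the limits of its slope and its intercept.\<close>

lemma norming_constants_doubling:
  assumes "\<alpha> > 0" and F: "distribution_function F"
    and conv: "tails_converge_on {-1<..0} F \<alpha> a b"
  shows "(\<lambda>n. a (2 * n) / a n) \<longlonglongrightarrow> (1 / 2) powr (1 / \<alpha>)"
    and "(\<lambda>n. (b (2 * n) - b n) / a n) \<longlonglongrightarrow> 0"
proof -
  note D = tails_converge_onD[OF conv]
  define \<rho> where "\<rho> = (1 / 2 :: real) powr (1 / \<alpha>)"
  have \<rho>: "0 < \<rho>" "\<rho> < 1" "\<rho> powr \<alpha> = 1 / 2"
    using assms(1) powr_less_mono2[of "1 / \<alpha>" "1 / 2" 1] by (simp_all add: \<rho>_def powr_powr)
  have double: "filterlim (\<lambda>n::nat. 2 * n) sequentially sequentially"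
    by (rule filterlim_subseq) (simp add: strict_mono_def)
  have loc: "(\<lambda>n. (a (2 * n) * x + b (2 * n) - b n) / a n) \<longlonglongrightarrow> \<rho> * x" if x: "-1 < x" "x < 0" for x
  proof (rule rescaled_location_tendsto[OF assms(1) F, where c = real, OF D(2) D(1)])
    show "-1 < \<rho> * x" "\<rho> * x < 0"
      using x \<rho> mult_strict_mono[of \<rho> 1 "- x" 1] by (auto simp: mult_pos_neg)
    have "(\<lambda>n. 1 / 2 * (real (2 * n) * tail F (a (2 * n) * x + b (2 * n)))) \<longlonglongrightarrow>
        1 / 2 * (- x) powr \<alpha>"
      by (intro tendsto_mult tendsto_const filterlim_compose[OF D(2)[OF x] double])
    moreover have "(- (\<rho> * x)) powr \<alpha> = 1 / 2 * (- x) powr \<alpha>"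
      using powr_mult[of \<rho> "- x" \<alpha>] x \<rho> by simp
    moreover have "1 / 2 * (real (2 * n) * t) = real n * t" for n t
      by simp
    ultimately show "(\<lambda>n. real n * tail F (a (2 * n) * x + b (2 * n))) \<longlonglongrightarrow> (- (\<rho> * x)) powr \<alpha>"
      by (simp only:)
  qed simp_all
  let ?g = "\<lambda>x n. (a (2 * n) * x + b (2 * n) - b n) / a n"
  have "(\<lambda>n. 4 * (?g (- 1 / 4) n - ?g (- 1 / 2) n)) \<longlonglongrightarrow> 4 * (\<rho> * (- 1 / 4) - \<rho> * (- 1 / 2))"
    by (intro tendsto_intros loc) auto
  moreover have "4 * (?g (- 1 / 4) n - ?g (- 1 / 2) n) = a (2 * n) / a n" for n
    using D(1)[of n] by (simp add: field_simps)
  ultimately show "(\<lambda>n. a (2 * n) / a n) \<longlonglongrightarrow> (1 / 2) powr (1 / \<alpha>)"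
    by (simp add: \<rho>_def)
  have "(\<lambda>n. 2 * ?g (- 1 / 4) n - ?g (- 1 / 2) n) \<longlonglongrightarrow> 2 * (\<rho> * (- 1 / 4)) - \<rho> * (- 1 / 2)"
    by (intro tendsto_intros loc) auto
  moreover have "2 * ?g (- 1 / 4) n - ?g (- 1 / 2) n = (b (2 * n) - b n) / a n" for n
    using D(1)[of n] by (simp add: field_simps)
  ultimately show "(\<lambda>n. (b (2 * n) - b n) / a n) \<longlonglongrightarrow> 0"
    by simp
qed

text \<open>Along \<open>2\<^sup>k n\<close> the scales shrink geometrically with some ratio \<open>r < 1\<close> and each doubling moves the
  location to the right by at most \<open>e (1 - r)\<close> times the current scale, so all locations stay left
  of \<open>b\<^sub>n + e a\<^sub>n\<close>. The tails at these locations tend to 0 by the limit relation at \<open>x = 0\<close>.\<close>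

lemma tail_eventually_0_right_of_location:
  assumes "\<alpha> > 0" and F: "distribution_function F"
    and conv: "tails_converge_on {-1<..0} F \<alpha> a b" and "e > 0"
  shows "\<forall>\<^sub>F n in sequentially. tail F (b n + e * a n) = 0"
proof -
  note D = tails_converge_onD[OF conv]
  note doubling = norming_constants_doubling[OF assms(1) F conv]
  define \<rho> where "\<rho> = (1 / 2 :: real) powr (1 / \<alpha>)"
  define r where "r = (\<rho> + 1) / 2"
  have "\<rho> < 1"
    using assms(1) powr_less_mono2[of "1 / \<alpha>" "1 / 2" 1] by (simp add: \<rho>_def)
  then have r: "\<rho> < r" "r < 1"
    by (simp_all add: r_def)
  have "\<forall>\<^sub>F n in sequentially. a (2 * n) / a n < r"
    using order_tendstoD(2)[OF doubling(1)] r by (simp add: \<rho>_def)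
  moreover have "\<forall>\<^sub>F n in sequentially. (b (2 * n) - b n) / a n < e * (1 - r)"
    using order_tendstoD(2)[OF doubling(2)] r \<open>e > 0\<close> by simp
  ultimately have "\<forall>\<^sub>F n in sequentially. n > 0 \<and> a (2 * n) \<le> r * a n \<and> b (2 * n) \<le> b n + e * (1 - r) * a n"
    using eventually_gt_at_top[of 0]
  proof eventually_elim
    case (elim n)
    then show ?case using D(1)[of n] by (simp add: divide_less_eq)
  qed
  then obtain N where N: "\<And>n. n \<ge> N \<Longrightarrow>
      n > 0 \<and> a (2 * n) \<le> r * a n \<and> b (2 * n) \<le> b n + e * (1 - r) * a n"
    by (auto simp: eventually_sequentially)
  have dyadic: "b (2 ^ k * n) \<le> b n + e * a n" if "n \<ge> N" for k n
    using that
  proof (induction k arbitrary: n)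
    case 0
    then show ?case using D(1)[of n] \<open>e > 0\<close> by simp
  next
    case (Suc k)
    have "b (2 ^ Suc k * n) = b (2 ^ k * (2 * n))"
      by (simp add: ac_simps)
    also have "\<dots> \<le> b (2 * n) + e * a (2 * n)"
      using Suc.prems by (intro Suc.IH) simp
    also have "\<dots> \<le> b n + e * (1 - r) * a n + e * (r * a n)"
      using N[OF Suc.prems] \<open>e > 0\<close> by (intro add_mono mult_left_mono) auto
    finally show ?case by (simp add: algebra_simps)
  qed
  have "tail F (b n + e * a n) = 0" if "n \<ge> N" for n
  proof -
    have "strict_mono (\<lambda>k. 2 ^ k * n)"
      using N[OF that] by (auto intro!: strict_monoI)
    then have "(\<lambda>k. tail F (b (2 ^ k * n))) \<longlonglongrightarrow> 0"
      using filterlim_compose[OF tendsto_0_if_scaled_tendsto[OF D(3)] filterlim_subseq] by blast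
    then have "tail F (b n + e * a n) \<le> 0"
      by (rule tendsto_lowerbound) (auto intro!: always_eventually tail_antimono[OF F] dyadic that)
    then show ?thesis
      using tail_bounds(1)[OF F, of "b n + e * a n"] by simp
  qed
  then show ?thesis
    by (auto simp: eventually_sequentially)
qed

lemma finite_endpoint_if_tails_converge:
  assumes "\<alpha> > 0" and F: "distribution_function F"
    and conv: "tails_converge_on {-1<..0} F \<alpha> a b"
  shows "right_endpoint F < \<infinity>"
proof -
  obtain n where "tail F (b n + 1 * a n) = 0"
    using eventually_happens'[OF sequentially_bot tail_eventually_0_right_of_location[OF assms, of 1]]
    by auto
  then show ?thesis
    using tail_eq_0_iff[OF F] by (auto intro: le_less_trans)
qed

text \<open>The tail vanishes just to the right of \<open>b\<^sub>n\<close> and is positive just to its left, on the scale of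
  \<open>a\<^sub>n\<close>; the endpoint lies in between.\<close>

lemma location_tendsto_endpoint:
  assumes "\<alpha> > 0" and F: "distribution_function F"
    and conv: "tails_converge_on {-1<..0} F \<alpha> a b"
    and end_iff: "\<And>x. tail F x = 0 \<longleftrightarrow> \<omega> \<le> x"
  shows "(\<lambda>n. (\<omega> - b n) / a n) \<longlonglongrightarrow> 0"
proof (rule order_tendstoI)
  note D = tails_converge_onD[OF conv]
  fix e :: real assume "e < 0"
  define y where "y = max e (- 1 / 2)"
  have y: "-1 < y" "y < 0" "e \<le> y"
    using \<open>e < 0\<close> by (auto simp: y_def max_def)
  have "\<forall>\<^sub>F n in sequentially. 0 < real n * tail F (a n * y + b n)"
    by (rule order_tendstoD(1)[OF D(2)[OF y(1,2)]]) (use y in simp)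
  then show "\<forall>\<^sub>F n in sequentially. e < (\<omega> - b n) / a n"
  proof eventually_elim
    case (elim n)
    then have "a n * y + b n < \<omega>"
      using end_iff[of "a n * y + b n"] by (auto simp: zero_less_mult_iff)
    then have "y < (\<omega> - b n) / a n"
      using D(1)[of n] by (simp add: less_divide_eq mult.commute)
    then show ?case using y by simp
  qed
next
  note D = tails_converge_onD[OF conv]
  fix e :: real assume "0 < e"
  have "\<forall>\<^sub>F n in sequentially. tail F (b n + e / 2 * a n) = 0"
    using \<open>0 < e\<close> by (intro tail_eventually_0_right_of_location[OF assms(1) F conv]) simp
  then show "\<forall>\<^sub>F n in sequentially. (\<omega> - b n) / a n < e"
  proof eventually_elim
    case (elim n)
    then have "\<omega> - b n \<le> e / 2 * a n"
      using end_iff[of "b n + e / 2 * a n"] by simp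
    then have "(\<omega> - b n) / a n \<le> e / 2"
      by (subst pos_divide_le_eq[OF D(1)])
    then show ?case using \<open>0 < e\<close> by linarith
  qed
qed

lemma tail_tendsto_0_if_tails_converge:
  assumes F: "distribution_function F"
    and conv: "tails_converge_on {-1<..0} F \<alpha> a b"
    and end_iff: "\<And>x. tail F x = 0 \<longleftrightarrow> \<omega> \<le> x"
  shows "((\<lambda>h. tail F (\<omega> - h)) \<longlongrightarrow> 0) (at_right 0)"
proof (rule order_tendstoI)
  fix e :: real assume "e < 0"
  then show "\<forall>\<^sub>F h in at_right 0. e < tail F (\<omega> - h)"
    using tail_bounds(1)[OF F] by (intro always_eventually) (auto intro: less_le_trans)
next
  fix e :: real assume "0 < e"
  define q where "q n = a n * (- 1 / 2) + b n" for n
  have lim: "(\<lambda>n. real n * tail F (q n)) \<longlonglongrightarrow> (- (- 1 / 2)) powr \<alpha>"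
    unfolding q_def by (rule tails_converge_onD(2)[OF conv]) auto
  have "\<forall>\<^sub>F n in sequentially. real n * tail F (q n) > 0"
    by (rule order_tendstoD(1)[OF lim]) simp
  moreover have "\<forall>\<^sub>F n in sequentially. tail F (q n) < e"
    using tendsto_0_if_scaled_tendsto[OF lim] \<open>0 < e\<close> by (rule order_tendstoD)
  ultimately have "\<forall>\<^sub>F n in sequentially. real n * tail F (q n) > 0 \<and> tail F (q n) < e"
    by eventually_elim simp
  then obtain n where n: "real n * tail F (q n) > 0" "tail F (q n) < e"
    using eventually_happens'[OF sequentially_bot] by blast
  then have "q n < \<omega>"
    using tail_pos_iff[OF F end_iff] by (auto simp: zero_less_mult_iff)
  then have "\<forall>\<^sub>F h in at_right 0. h < \<omega> - q n"
    by (intro order_tendstoD(2)[OF tendsto_ident_at]) simp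
  then show "\<forall>\<^sub>F h in at_right 0. tail F (\<omega> - h) < e"
  proof eventually_elim
    case (elim h)
    then show ?case
      using tail_antimono[OF F, of "q n" "\<omega> - h"] n(2) by simp
  qed
qed

text \<open>This passes from the discrete index \<open>n\<close> to a continuous parameter: with \<open>n = \<lfloor>c / U\<rfloor>\<close> the product
  \<open>n U\<close> misses \<open>c\<close> by at most \<open>U\<close>.\<close>

lemma sample_size_tendsto:
  fixes U :: "'i \<Rightarrow> real"
  assumes "c > 0" and U: "(U \<longlongrightarrow> 0) \<F>" "\<forall>\<^sub>F i in \<F>. U i > 0"
  shows "filterlim (\<lambda>i. nat \<lfloor>c / U i\<rfloor>) sequentially \<F>"
    and "((\<lambda>i. real (nat \<lfloor>c / U i\<rfloor>) * U i) \<longlongrightarrow> c) \<F>"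
proof -
  have "filterlim (\<lambda>i. c / U i) at_top \<F>"
    using \<open>c > 0\<close> by (rule LIM_at_top_divide[OF tendsto_const _ U])
  then show "filterlim (\<lambda>i. nat \<lfloor>c / U i\<rfloor>) sequentially \<F>"
    by (intro filterlim_compose[OF filterlim_nat_sequentially] filterlim_compose[OF filterlim_floor_sequentially])
  show "((\<lambda>i. real (nat \<lfloor>c / U i\<rfloor>) * U i) \<longlongrightarrow> c) \<F>"
  proof (rule tendsto_sandwich)
    show "\<forall>\<^sub>F i in \<F>. c - U i \<le> real (nat \<lfloor>c / U i\<rfloor>) * U i"
      using U(2)
    proof eventually_elim
      case (elim i)
      have "c / U i \<le> real (nat \<lfloor>c / U i\<rfloor>) + 1" by linarith
      then have "c \<le> (real (nat \<lfloor>c / U i\<rfloor>) + 1) * U i"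
        by (simp only: pos_divide_le_eq[OF elim])
      then show ?case
        by (simp add: algebra_simps)
    qed
    show "\<forall>\<^sub>F i in \<F>. real (nat \<lfloor>c / U i\<rfloor>) * U i \<le> c"
      using U(2)
    proof eventually_elim
      case (elim i)
      have "0 \<le> c / U i" using elim \<open>c > 0\<close> by simp
      then have "real (nat \<lfloor>c / U i\<rfloor>) \<le> c / U i" by linarith
      then show ?case
        using elim by (simp add: le_divide_eq)
    qed
    show "((\<lambda>i. c - U i) \<longlongrightarrow> c) \<F>"
      using tendsto_diff[OF tendsto_const U(1)] by simp
  qed simp
qed

lemma regularly_varying_if_tails_converge:
  assumes "\<alpha> > 0" and F: "distribution_function F"
    and conv: "tails_converge_on {-1<..0} F \<alpha> a b"
  shows "regularly_varying_tail_at_endpoint F \<alpha>"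
proof -
  note D = tails_converge_onD[OF conv]
  have fin: "right_endpoint F < \<infinity>"
    by (rule finite_endpoint_if_tails_converge[OF assms])
  then obtain \<omega> where \<omega>: "right_endpoint F = ereal \<omega>" and end_iff: "\<And>x. tail F x = 0 \<longleftrightarrow> \<omega> \<le> x"
    by (rule finite_right_endpointE[OF F]) blast
  define U where "U h = tail F (\<omega> - h)" for h
  have U_0: "(U \<longlongrightarrow> 0) (at_right 0)"
    unfolding U_def by (rule tail_tendsto_0_if_tails_converge[OF F conv end_iff])
  have U_pos: "\<forall>\<^sub>F h in at_right 0. U h > 0"
    using eventually_at_right_less
    by eventually_elim (simp add: U_def tail_pos_iff[OF F end_iff])
  have "((\<lambda>h. U (x * h) / U h) \<longlongrightarrow> x powr \<alpha>) (at_right 0)" if "x > 0" for x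
  proof -
    \<comment> \<open>The limit relation is available on \<open>(-1, 0)\<close> only, so the positions \<open>- s\<close> of \<open>\<omega> - h\<close> and
      \<open>- x s\<close> of \<open>\<omega> - x h\<close> must both lie there.\<close>
    define s where "s = 1 / (2 + x)"
    have s: "0 < s" "s < 1" "0 < x * s" "x * s < 1"
      using \<open>x > 0\<close> by (simp_all add: s_def field_simps)
    define N where "N h = nat \<lfloor>s powr \<alpha> / U h\<rfloor>" for h
    have N: "filterlim N sequentially (at_right 0)"
      and NU: "((\<lambda>h. real (N h) * U h) \<longlongrightarrow> s powr \<alpha>) (at_right 0)"
      unfolding N_def using sample_size_tendsto[OF _ U_0 U_pos, of "s powr \<alpha>"] s by simp_all
    have convN: "((\<lambda>h. real (N h) * tail F (a (N h) * y + b (N h))) \<longlongrightarrow> (- y) powr \<alpha>) (at_right 0)"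
      if "-1 < y" "y < 0" for y
      by (rule filterlim_compose[OF D(2)[OF that] N])
    have "((\<lambda>h. (\<omega> - h - b (N h)) / a (N h)) \<longlongrightarrow> - s) (at_right 0)"
      by (rule rescaled_location_tendsto[OF assms(1) F, where c = "\<lambda>h. real (N h)", OF convN])
         (use s D(1) NU in \<open>auto simp: U_def\<close>)
    moreover have "((\<lambda>h. (\<omega> - b (N h)) / a (N h)) \<longlongrightarrow> 0) (at_right 0)"
      by (rule filterlim_compose[OF location_tendsto_endpoint[OF assms end_iff] N])
    ultimately have "((\<lambda>h. x * ((\<omega> - h - b (N h)) / a (N h)) + (1 - x) * ((\<omega> - b (N h)) / a (N h)))
        \<longlongrightarrow> x * (- s) + (1 - x) * 0) (at_right 0)"
      by (intro tendsto_intros)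
    moreover have "x * ((\<omega> - h - b (N h)) / a (N h)) + (1 - x) * ((\<omega> - b (N h)) / a (N h)) =
        (\<omega> - x * h - b (N h)) / a (N h)" for h
      using D(1)[of "N h"] by (simp add: field_simps)
    ultimately have "((\<lambda>h. (\<omega> - x * h - b (N h)) / a (N h)) \<longlongrightarrow> - (x * s)) (at_right 0)"
      by simp
    then have "((\<lambda>h. real (N h) * U (x * h)) \<longlongrightarrow> (- (- (x * s))) powr \<alpha>) (at_right 0)"
      unfolding U_def using s
      by (intro scaled_tail_tendsto[OF F, where c = "\<lambda>h. real (N h)", OF convN] D(1)) auto
    then have "((\<lambda>h. (real (N h) * U (x * h)) / (real (N h) * U h)) \<longlongrightarrow>
        (- (- (x * s))) powr \<alpha> / s powr \<alpha>) (at_right 0)"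
      using s by (intro tendsto_divide NU) auto
    moreover have "(- (- (x * s))) powr \<alpha> / s powr \<alpha> = x powr \<alpha>"
      using s \<open>x > 0\<close> by (simp add: powr_mult)
    moreover have "\<forall>\<^sub>F h in at_right 0. (real (N h) * U (x * h)) / (real (N h) * U h) = U (x * h) / U h"
      using eventually_compose_filterlim[OF eventually_gt_at_top[of 0] N]
      by eventually_elim simp
    ultimately show ?thesis
      by (auto elim: Lim_transform_eventually)
  qed
  then show ?thesis
    using fin by (simp add: regularly_varying_tail_at_endpoint_def regularly_varying_at_0_def \<omega> U_def)
qed

section \<open>The equivalence\<close>

lemma norming_if_regularly_varying:
  assumes "\<alpha> > 0" and F: "distribution_function F"
    and rv: "regularly_varying_tail_at_endpoint F \<alpha>"
  shows "\<exists>a b. (\<forall>\<^sub>F n in sequentially.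
             a n = real_of_ereal (right_endpoint F) - tail_quantile F n \<and>
             b n = real_of_ereal (right_endpoint F)) \<and>
           free_max_norming F (free_weibull \<alpha>) a b \<and>
           classical_max_norming F (weibull \<alpha>) a b"
proof -
  have "right_endpoint F < \<infinity>"
    using rv by (simp add: regularly_varying_tail_at_endpoint_def)
  then obtain \<omega> where \<omega>: "right_endpoint F = ereal \<omega>" and end_iff: "\<And>x. tail F x = 0 \<longleftrightarrow> \<omega> \<le> x"
    by (rule finite_right_endpointE[OF F]) blast
  have rv': "regularly_varying_at_0 (\<lambda>u. tail F (\<omega> - u)) \<alpha>"
    using rv by (simp add: regularly_varying_tail_at_endpoint_def \<omega>)
  \<comment> \<open>The value 1 only serves to keep the scale positive for \<open>n < 2\<close>, where the quantile is the
    infimum of an empty set or of one that need not be bounded below.\<close>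
  define a where "a n = (if n \<ge> 2 then \<omega> - tail_quantile F n else 1)" for n
  have a_pos: "a n > 0" for n
    using tail_quantile_less_endpoint[OF F tail_tendsto_0_at_endpoint[OF assms(1) F end_iff rv']]
    by (simp add: a_def)
  have a: "\<forall>\<^sub>F n in sequentially. a n = \<omega> - tail_quantile F n"
    using eventually_ge_at_top[of 2] by eventually_elim (simp add: a_def)
  have conv: "tails_converge_on UNIV F \<alpha> a (\<lambda>n. \<omega>)"
    by (rule tails_converge_at_endpoint[OF assms(1) F end_iff rv' a_pos a])
  show ?thesis
    using a free_max_norming_if_tails_converge[OF assms(1) F conv]
      classical_max_norming_iff[OF assms(1) F] conv
    by (intro exI[of _ a] exI[of _ "\<lambda>n. \<omega>"]) (simp add: \<omega>)
qed

theorem theorem6p13: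
  fixes \<alpha> :: real and F :: "real \<Rightarrow> real"
  assumes "\<alpha> > 0" and "distribution_function F"
  shows "(in_free_max_domain F (free_weibull \<alpha>) \<longleftrightarrow> in_classical_max_domain F (weibull \<alpha>)) \<and>
         (in_classical_max_domain F (weibull \<alpha>) \<longleftrightarrow> regularly_varying_tail_at_endpoint F \<alpha>) \<and>
         (regularly_varying_tail_at_endpoint F \<alpha> \<longrightarrow>
           (\<exists>a b. (\<forall>\<^sub>F n in sequentially.
                     a n = real_of_ereal (right_endpoint F) - tail_quantile F n \<and>
                     b n = real_of_ereal (right_endpoint F)) \<and>
              free_max_norming F (free_weibull \<alpha>) a b \<and>
              classical_max_norming F (weibull \<alpha>) a b))"
proof -
  have free: "regularly_varying_tail_at_endpoint F \<alpha>" if "in_free_max_domain F (free_weibull \<alpha>)"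
    using that tails_converge_if_free_max_norming[OF assms]
      regularly_varying_if_tails_converge[OF assms]
    by (auto simp: in_free_max_domain_def)
  have classical: "regularly_varying_tail_at_endpoint F \<alpha>"
    if dom: "in_classical_max_domain F (weibull \<alpha>)"
  proof -
    obtain a b where "tails_converge_on UNIV F \<alpha> a b"
      using dom unfolding in_classical_max_domain_def classical_max_norming_iff[OF assms] by blast
    then have "tails_converge_on {-1<..0} F \<alpha> a b"
      unfolding tails_converge_on_def by blast
    then show ?thesis
      by (rule regularly_varying_if_tails_converge[OF assms])
  qed
  show ?thesis
    using free classical norming_if_regularly_varying[OF assms]
    by (auto simp: in_free_max_domain_def in_classical_max_domain_def)
qed

end
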